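(* Let $T>0$, let $\sigma=\{(x,0)\,|\,0\leqslant x\leqslant \beta\}$ be a finite segment of the boundary of the half-plane $\mathbb R^2_+$, let $\mathscr F^{2T}_\sigma=L_2(\sigma\times[0,2T])$ with inner product $(f,h)_{\mathscr F^{2T}_\sigma}=\int_{\sigma\times[0,2T]} f(x,t)\,h(x,t)\,\rho(x,0)\,dx\,dt$, and let $M^{2T}:=J^{2T}R^{2T}$, where $R^{2T}$ is the extended response operator and $J^{2T}$ is integration in time. Let $M,N\geqslant 1$ be integers, $\varepsilon=\beta/M$, $\delta=2T/N$, let $g=g(x,t)$ be a square-integrable function on $\mathbb R^2$ with ${\rm supp}\,g=\Delta^0_0:=[0,\varepsilon]\times[0,\delta]$, and put $$g^i_j(x,t):=g(x-j\varepsilon,\,t-i\delta),\qquad j=0,1,\dots,M-1,\quad i=0,1,\dots,N-1.$$ Then the entries of the Gram matrix $$G^{ik}_{jl}:=\left([M^{2T}+(M^{2T})^*]\,g^i_j\,,\,g^k_l\right)_{\mathscr F^{2T}_\sigma},\qquad j,l=0,\dots,M-1,\quad i,k=0,\dots,N-1,$$ depend on $i$ and $k$ only through the difference $k-i$. That is, the matrix $\{G^{ik}_{jl}\}$, viewed as an $N\times N$ array (indexed by $i,k$) of blocks of size $M\times M$ (indexed by $j,l$), is a block-Toeplitz matrix.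
   Context: Let $\mathbb R^2_+=\{(x,y)\in\mathbb R^2\,|\,y>0\}$, let $\rho=\rho(x,y)$ be a smooth positive function, let ${\rm dist}$ be the Euclidean distance in $\overline{\mathbb R^2_+}$, and let $\Omega^T_\sigma=\{p\in\mathbb R^2_+\,|\,{\rm dist}(p,\sigma)<T\}$. Points of $\sigma$ are identified with their coordinate $x$. For a control $f\in\mathscr F^{2T}_\sigma$, $u^f=u^f(x,y,t)$ denotes the solution of the (well-posed) extended problem $$u_{tt}-\Delta u-\langle\nabla\ln\rho,\nabla u\rangle=0\quad\text{for } p=(x,y)\in\Omega^T_\sigma,\ 0<t<2T-{\rm dist}(p,\sigma),$$ $$u=0\quad\text{for } t<{\rm dist}(p,\sigma),\qquad u_y|_{y=0}=f\quad\text{for }0\leqslant t\leqslant 2T.$$ The extended response operator $R^{2T}:\mathscr F^{2T}_\sigma\to\mathscr F^{2T}_\sigma$ is $(R^{2T}f)(x,t):=u^f(x,0,t)$ for $x\in\sigma$, $0\leqslant t\leqslant 2T$. It is compact and is known to have the representation $$(R^{2T}f)(x,t)=\int_0^t ds\int_\sigma r(x,x';t-s)\,f(x',s)\,dx',\qquad x\in\sigma,\ 0\leqslant t\leqslant 2T,$$ with a kernel $r$ (taken to be piecewise continuous). The integration operator is $(J^{2T}f)(\cdot,t):=\int_0^t f(\cdot,s)\,ds$, $0\leqslant t\leqslant 2T$. The star denotes the adjoint with respect to the inner product of $\mathscr F^{2T}_\sigma$. *)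

theory Defs
  imports "HOL-Analysis.Analysis"
begin

section \<open>Smooth functions\<close>

definition dir_deriv :: "'a::euclidean_space \<Rightarrow> ('a \<Rightarrow> real) \<Rightarrow> 'a \<Rightarrow> real" where
  "dir_deriv b f p = frechet_derivative f (at p) b"

text \<open>Used for open \<open>U\<close> only, where \<open>differentiable_on\<close> is differentiability at every point.\<close>

fun Ck_on :: "nat \<Rightarrow> 'a::euclidean_space set \<Rightarrow> ('a \<Rightarrow> real) \<Rightarrow> bool" where
  "Ck_on 0 U f \<longleftrightarrow> continuous_on U f"
| "Ck_on (Suc k) U f \<longleftrightarrow> f differentiable_on U \<and> (\<forall>b\<in>Basis. Ck_on k U (dir_deriv b f))"

text \<open>
  Regularity on a set that contains part of its boundary (such as the closed half-plane) means, as
  usual, regularity of an extension to an open neighbourhood. The functions below are total, so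
  the extension is taken to be the function itself; its values off the set play no role.
\<close>

definition Ck_near :: "nat \<Rightarrow> 'a::euclidean_space set \<Rightarrow> ('a \<Rightarrow> real) \<Rightarrow> bool" where
  "Ck_near k S f \<longleftrightarrow> (\<exists>U. open U \<and> S \<subseteq> U \<and> Ck_on k U f)"

definition smooth_near :: "'a::euclidean_space set \<Rightarrow> ('a \<Rightarrow> real) \<Rightarrow> bool" where
  "smooth_near S f \<longleftrightarrow> (\<exists>U. open U \<and> S \<subseteq> U \<and> (\<forall>k. Ck_on k U f))"

definition smooth_positive_density :: "(real \<times> real \<Rightarrow> real) \<Rightarrow> bool" where
  "smooth_positive_density \<rho> \<longleftrightarrow>
     smooth_near {p. 0 \<le> snd p} \<rho> \<and> (\<forall>p. 0 \<le> snd p \<longrightarrow> 0 < \<rho> p)"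

section \<open>The space of controls\<close>

text \<open>
  An element of the space $L_2$ over \<open>time_strip\<close> is represented by a Borel function on the plane,
  two representatives being identified when they agree almost everywhere on the strip.
  A point of \<open>time_strip\<close> is \<open>(x, t)\<close>, with \<open>x\<close> the coordinate on \<open>\<sigma>\<close>.
\<close>

definition time_strip :: "real \<Rightarrow> real \<Rightarrow> (real \<times> real) set" where
  "time_strip \<beta> T = {0..\<beta>} \<times> {0..2 * T}"

definition controls ::
    "(real \<times> real \<Rightarrow> real) \<Rightarrow> real \<Rightarrow> real \<Rightarrow> (real \<times> real \<Rightarrow> real) set" where
  "controls \<rho> \<beta> T =
     {f. f \<in> borel_measurable borel \<and>
         set_integrable lborel (time_strip \<beta> T) (\<lambda>p. (f p)\<^sup>2 * \<rho> (fst p, 0))}"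

definition control_inner ::
    "(real \<times> real \<Rightarrow> real) \<Rightarrow> real \<Rightarrow> real \<Rightarrow>
     (real \<times> real \<Rightarrow> real) \<Rightarrow> (real \<times> real \<Rightarrow> real) \<Rightarrow> real" where
  "control_inner \<rho> \<beta> T f h =
     (LINT p : time_strip \<beta> T | lborel. f p * h p * \<rho> (fst p, 0))"

definition control_sqdist ::
    "(real \<times> real \<Rightarrow> real) \<Rightarrow> real \<Rightarrow> real \<Rightarrow>
     (real \<times> real \<Rightarrow> real) \<Rightarrow> (real \<times> real \<Rightarrow> real) \<Rightarrow> ennreal" where
  "control_sqdist \<rho> \<beta> T f h =
     (\<integral>\<^sup>+ p \<in> time_strip \<beta> T. ennreal ((f p - h p)\<^sup>2 * \<rho> (fst p, 0)) \<partial>lborel)"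

definition adjoint_of ::
    "(real \<times> real \<Rightarrow> real) \<Rightarrow> real \<Rightarrow> real \<Rightarrow>
     ((real \<times> real \<Rightarrow> real) \<Rightarrow> real \<times> real \<Rightarrow> real) \<Rightarrow>
     ((real \<times> real \<Rightarrow> real) \<Rightarrow> real \<times> real \<Rightarrow> real) \<Rightarrow> bool" where
  "adjoint_of \<rho> \<beta> T A B \<longleftrightarrow>
     (\<forall>h\<in>controls \<rho> \<beta> T. B h \<in> controls \<rho> \<beta> T) \<and>
     (\<forall>f\<in>controls \<rho> \<beta> T. \<forall>h\<in>controls \<rho> \<beta> T.
        control_inner \<rho> \<beta> T (A f) h = control_inner \<rho> \<beta> T f (B h))"

section \<open>The extended problem\<close>

text \<open>Points of space-time are \<open>((x, y), t)\<close>.\<close>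

abbreviation (input) e_x :: "(real \<times> real) \<times> real" where "e_x \<equiv> ((1, 0), 0)"
abbreviation (input) e_y :: "(real \<times> real) \<times> real" where "e_y \<equiv> ((0, 1), 0)"
abbreviation (input) e_t :: "(real \<times> real) \<times> real" where "e_t \<equiv> ((0, 0), 1)"

definition seg :: "real \<Rightarrow> (real \<times> real) set" where
  "seg \<beta> = {0..\<beta>} \<times> {0}"

definition \<Omega> :: "real \<Rightarrow> real \<Rightarrow> (real \<times> real) set" where
  "\<Omega> \<beta> T = {p. 0 < snd p \<and> infdist p (seg \<beta>) < T}"

definition wave_domain :: "real \<Rightarrow> real \<Rightarrow> ((real \<times> real) \<times> real) set" where
  "wave_domain \<beta> T = {(p, t). p \<in> \<Omega> \<beta> T \<and> 0 < t \<and> t < 2 * T - infdist p (seg \<beta>)}"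

text \<open>
  Here the boundary points with \<open>y = 0\<close> are included, and so are negative times, at which the
  condition \<open>u = 0\<close> for \<open>t < dist(p, \<sigma>)\<close> is imposed as well; this also makes \<open>u\<close> start from rest.
\<close>

definition wave_domain_ext :: "real \<Rightarrow> real \<Rightarrow> ((real \<times> real) \<times> real) set" where
  "wave_domain_ext \<beta> T =
     {(p, t). 0 \<le> snd p \<and> infdist p (seg \<beta>) < T \<and> t < 2 * T - infdist p (seg \<beta>)}"

definition wave_operator ::
    "(real \<times> real \<Rightarrow> real) \<Rightarrow> ((real \<times> real) \<times> real \<Rightarrow> real) \<Rightarrow>
     (real \<times> real) \<times> real \<Rightarrow> real" where
  "wave_operator \<rho> u z =
     dir_deriv e_t (dir_deriv e_t u) z
     - (dir_deriv e_x (dir_deriv e_x u) z + dir_deriv e_y (dir_deriv e_y u) z)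
     - (dir_deriv (1, 0) (\<lambda>q. ln (\<rho> q)) (fst z) * dir_deriv e_x u z
        + dir_deriv (0, 1) (\<lambda>q. ln (\<rho> q)) (fst z) * dir_deriv e_y u z)"

text \<open>
  Smooth controls supported strictly inside \<open>\<sigma> \<times> [0, 2T]\<close>. They are dense in the space of controls
  and satisfy all compatibility conditions, so that the solution is classical. Such a control
  vanishes at boundary points outside \<open>\<sigma>\<close>, where the Neumann condition is homogeneous.
\<close>

definition smooth_controls :: "real \<Rightarrow> real \<Rightarrow> (real \<times> real \<Rightarrow> real) set" where
  "smooth_controls \<beta> T =
     {f. smooth_near UNIV f \<and> closure {p. f p \<noteq> 0} \<subseteq> {0<..<\<beta>} \<times> {0<..<2 * T}}"

definition classical_solution ::
    "(real \<times> real \<Rightarrow> real) \<Rightarrow> real \<Rightarrow> real \<Rightarrow>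
     (real \<times> real \<Rightarrow> real) \<Rightarrow> ((real \<times> real) \<times> real \<Rightarrow> real) \<Rightarrow> bool" where
  "classical_solution \<rho> \<beta> T f u \<longleftrightarrow>
     Ck_near 2 (wave_domain_ext \<beta> T) u \<and>
     (\<forall>z\<in>wave_domain \<beta> T. wave_operator \<rho> u z = 0) \<and>
     (\<forall>(p, t)\<in>wave_domain_ext \<beta> T. t < infdist p (seg \<beta>) \<longrightarrow> u (p, t) = 0) \<and>
     (\<forall>x t. ((x, 0), t) \<in> wave_domain_ext \<beta> T \<and> 0 \<le> t \<longrightarrow>
        dir_deriv e_y u ((x, 0), t) = f (x, t))"

text \<open>
  For a control that is merely square-integrable, the solution is the limit of classical ones
  (in $L_2$ of the space-time domain, together with the traces on \<open>\<sigma>\<close>). The trace is recorded as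
  the values of \<open>u\<close> at \<open>y = 0\<close>, a set that is null in space-time.
\<close>

definition boundary_trace :: "((real \<times> real) \<times> real \<Rightarrow> real) \<Rightarrow> real \<times> real \<Rightarrow> real" where
  "boundary_trace u = (\<lambda>(x, t). u ((x, 0), t))"

definition solution ::
    "(real \<times> real \<Rightarrow> real) \<Rightarrow> real \<Rightarrow> real \<Rightarrow>
     (real \<times> real \<Rightarrow> real) \<Rightarrow> ((real \<times> real) \<times> real \<Rightarrow> real) \<Rightarrow> bool" where
  "solution \<rho> \<beta> T f u \<longleftrightarrow>
     u \<in> borel_measurable borel \<and>
     (\<exists>fn un.
        (\<forall>n. fn n \<in> smooth_controls \<beta> T \<and> classical_solution \<rho> \<beta> T (fn n) (un n)) \<and>
        (\<lambda>n. control_sqdist \<rho> \<beta> T (fn n) f) \<longlonglongrightarrow> 0 \<and>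
        (\<lambda>n. \<integral>\<^sup>+ z \<in> wave_domain \<beta> T. ennreal ((un n z - u z)\<^sup>2) \<partial>lborel) \<longlonglongrightarrow> 0 \<and>
        (\<lambda>n. control_sqdist \<rho> \<beta> T (boundary_trace (un n)) (boundary_trace u)) \<longlonglongrightarrow> 0)"

definition well_posed :: "(real \<times> real \<Rightarrow> real) \<Rightarrow> real \<Rightarrow> real \<Rightarrow> bool" where
  "well_posed \<rho> \<beta> T \<longleftrightarrow>
     (\<forall>f\<in>controls \<rho> \<beta> T.
        (\<exists>u. solution \<rho> \<beta> T f u) \<and>
        (\<forall>u v. solution \<rho> \<beta> T f u \<and> solution \<rho> \<beta> T f v \<longrightarrow>
           (AE z in lborel. z \<in> wave_domain \<beta> T \<longrightarrow> u z = v z) \<and>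
           (AE p in lborel. p \<in> time_strip \<beta> T \<longrightarrow> boundary_trace u p = boundary_trace v p)))"

section \<open>The extended response operator\<close>

definition response_operator ::
    "(real \<times> real \<Rightarrow> real) \<Rightarrow> real \<Rightarrow> real \<Rightarrow>
     ((real \<times> real \<Rightarrow> real) \<Rightarrow> real \<times> real \<Rightarrow> real) \<Rightarrow> bool" where
  "response_operator \<rho> \<beta> T R \<longleftrightarrow>
     (\<forall>f\<in>controls \<rho> \<beta> T. R f \<in> controls \<rho> \<beta> T \<and>
        (\<forall>u. solution \<rho> \<beta> T f u \<longrightarrow>
           (AE p in lborel. p \<in> time_strip \<beta> T \<longrightarrow> R f p = boundary_trace u p)))"

text \<open>
  The pieces are relatively open and cover \<open>K\<close> up to a null set. One-sided limits at the interfaces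
  are not required: in two space dimensions the kernel has an inverse square root singularity
  at \<open>\<bar>x - x'\<bar> = t\<close>. Convergence of the integral is therefore part of \<open>represented_by\<close>.
\<close>

definition piecewise_continuous_on ::
    "'a::euclidean_space set \<Rightarrow> ('a \<Rightarrow> real) \<Rightarrow> bool" where
  "piecewise_continuous_on K r \<longleftrightarrow>
     (\<exists>P. finite P \<and> disjoint P \<and> (\<forall>U\<in>P. open U \<and> continuous_on (U \<inter> K) r) \<and>
          negligible (K - \<Union>P))"

definition represented_by ::
    "(real \<times> real \<Rightarrow> real) \<Rightarrow> real \<Rightarrow> real \<Rightarrow>
     ((real \<times> real \<Rightarrow> real) \<Rightarrow> real \<times> real \<Rightarrow> real) \<Rightarrow>
     (real \<Rightarrow> real \<Rightarrow> real \<Rightarrow> real) \<Rightarrow> bool" where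
  "represented_by \<rho> \<beta> T R r \<longleftrightarrow>
     (\<forall>f\<in>controls \<rho> \<beta> T. AE (x, t) in lborel. (x, t) \<in> time_strip \<beta> T \<longrightarrow>
        set_integrable lborel ({0..\<beta>} \<times> {0..t}) (\<lambda>(x', s). r x x' (t - s) * f (x', s)) \<and>
        R f (x, t) =
          (LINT s : {0..t} | lborel. LINT x' : {0..\<beta>} | lborel. r x x' (t - s) * f (x', s)))"

definition time_integral :: "(real \<times> real \<Rightarrow> real) \<Rightarrow> real \<times> real \<Rightarrow> real" where
  "time_integral f = (\<lambda>(x, t). LINT s : {0..t} | lborel. f (x, s))"

section \<open>The Gram matrix\<close>

text \<open>
  The support of an element of $L_2$: the complement of the largest open set on which it vanishes
  almost everywhere.
\<close>

definition ess_support :: "(real \<times> real \<Rightarrow> real) \<Rightarrow> (real \<times> real) set" where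
  "ess_support g = - \<Union>{U. open U \<and> (AE p in lborel. p \<in> U \<longrightarrow> g p = 0)}"

definition shifted ::
    "real \<Rightarrow> real \<Rightarrow> (real \<times> real \<Rightarrow> real) \<Rightarrow> nat \<Rightarrow> nat \<Rightarrow> real \<times> real \<Rightarrow> real" where
  "shifted \<epsilon> \<delta> g i j = (\<lambda>(x, t). g (x - real j * \<epsilon>, t - real i * \<delta>))"

text \<open>
  \<open>G i k j l\<close> is the entry \<open>(j, l)\<close> of the block \<open>(i, k)\<close>; there are \<open>N \<times> N\<close> blocks of size \<open>M \<times> M\<close>.
\<close>

definition block_toeplitz :: "nat \<Rightarrow> nat \<Rightarrow> (nat \<Rightarrow> nat \<Rightarrow> nat \<Rightarrow> nat \<Rightarrow> real) \<Rightarrow> bool" where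
  "block_toeplitz N M G \<longleftrightarrow>
     (\<exists>B :: int \<Rightarrow> nat \<Rightarrow> nat \<Rightarrow> real.
        \<forall>i<N. \<forall>k<N. \<forall>j<M. \<forall>l<M. G i k j l = B (int k - int i) j l)"

end

theory Submission
  imports Defs
begin

text \<open>
  The medium does not change with time, so the response to a delayed control is the delayed
  response: the kernel of \<open>R\<close> depends on the two times only through their difference, and a control
  that vanishes at negative times can be shifted under the integral (\<open>response_delay\<close>). Integration
  in time inherits this (\<open>time_integral_delay\<close>), hence so does \<open>MT\<close>.

  By the definition of the adjoint, the entry \<open>G i k j l\<close> is \<open>A i k j l + A k i l j\<close>, where
  \<open>A i k j l\<close> is the inner product of \<open>MT (shifted \<epsilon> \<delta> g i j)\<close> with \<open>shifted \<epsilon> \<delta> g k l\<close>. This uses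
  additivity of the inner product, which for Bochner integrals requires that \<open>MT\<close> maps controls to
  controls (\<open>time_integral_in_controls\<close>). For \<open>i \<le> k\<close> the common delay \<open>i\<delta>\<close> is removed from both
  factors of \<open>A\<close> (\<open>control_inner_delay\<close>), which leaves \<open>A 0 (k - i) j l\<close>. For \<open>i > k\<close> causality
  gives \<open>A i k j l = 0\<close>: the first factor vanishes before the time \<open>i\<delta>\<close>, when the second one is
  already over. In both cases \<open>A\<close> depends on \<open>i\<close> and \<open>k\<close> through \<open>k - i\<close> only.
\<close>

section \<open>Null sets and translations\<close>

lemma AE_translate:
  fixes a :: "'a::euclidean_space"
  assumes "AE p in lborel. P p"
  shows "AE p in lborel. P (p - a)"
proof -
  obtain N where "N \<in> null_sets lborel" and N: "{p. \<not> P p} \<subseteq> N"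
    using assms by (auto simp: eventually_ae_filter)
  then have "{p. p - a \<in> N} \<in> null_sets lborel"
    by (intro null_sets_translation)
  then show ?thesis
    by (rule AE_I') (use N in auto)
qed

lemma AE_fst:
  fixes Q :: "real \<Rightarrow> bool"
  assumes "AE x in lborel. Q x"
  shows "AE p in (lborel :: (real \<times> real) measure). Q (fst p)"
proof -
  obtain N where "N \<in> null_sets lborel" and N: "{x. \<not> Q x} \<subseteq> N"
    using assms by (auto simp: eventually_ae_filter)
  then have "N \<times> (UNIV :: real set) \<in> null_sets (lborel \<Otimes>\<^sub>M lborel)"
    by (intro lborel.times_in_null_sets1) auto
  then show ?thesis
    unfolding lborel_prod by (rule AE_I') (use N in auto)
qed

lemma AE_slices:
  fixes Q :: "real \<times> real \<Rightarrow> bool"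
  assumes "AE p in lborel. Q p"
  shows "AE x in lborel. AE t in lborel. Q (x, t)"
  using lborel_pair.AE_pair[of Q, unfolded lborel_prod, OF assms] .

lemma integral_translate:
  fixes f :: "'a::euclidean_space \<Rightarrow> real"
  assumes [measurable]: "f \<in> borel_measurable borel"
  shows "(LINT p | lborel. f (p + a)) = (LINT p | lborel. f p)"
proof -
  have "(LINT p | lborel. f p) = (LINT p | distr lborel borel ((+) a). f p)"
    by (simp add: lborel_distr_plus)
  also have "\<dots> = (LINT p | lborel. f (a + p))"
    by (intro integral_distr) auto
  finally show ?thesis
    by (simp add: add.commute)
qed

text \<open>
  The complement of the essential support is a union of possibly uncountably many open sets, each
  of which meets the nonzero set of \<open>g\<close> in a null set; by the Lindelof property countably many
  of them suffice.
\<close>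

lemma AE_zero_off_ess_support: "AE p in lborel. p \<notin> ess_support g \<longrightarrow> g p = 0"
proof -
  define F where "F = {U. open U \<and> (AE p in lborel. p \<in> U \<longrightarrow> g p = 0)}"
  obtain F' where F': "F' \<subseteq> F" "countable F'" "\<Union>F' = \<Union>F"
    using Lindelof[of F] by (auto simp: F_def)
  have "AE p in lborel. \<forall>U\<in>F'. p \<in> U \<longrightarrow> g p = 0"
    using F' by (subst AE_ball_countable) (auto simp: F_def)
  then show ?thesis
  proof eventually_elim
    case (elim p)
    then show ?case
      using F'(3) by (auto simp: ess_support_def simp flip: F_def)
  qed
qed

section \<open>The Hilbert space of controls\<close>

lemma density_trace_continuous:
  assumes "smooth_positive_density \<rho>"
  shows "continuous_on UNIV (\<lambda>x. \<rho> (x, 0))"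
proof -
  obtain U where U: "{p. 0 \<le> snd p} \<subseteq> U" "\<forall>k. Ck_on k U \<rho>"
    using assms by (auto simp: smooth_positive_density_def smooth_near_def)
  then have "continuous_on U \<rho>"
    by (metis Ck_on.simps(1))
  moreover have "continuous_on UNIV (\<lambda>x :: real. (x, 0 :: real))"
    by (intro continuous_intros)
  ultimately show ?thesis
    by (rule continuous_on_compose2) (use U(1) in auto)
qed

lemma density_trace_measurable:
  assumes "smooth_positive_density \<rho>"
  shows "(\<lambda>p :: real \<times> real. \<rho> (fst p, 0)) \<in> borel_measurable borel"
proof -
  have "(\<lambda>x. \<rho> (x, 0)) \<in> borel_measurable borel"
    by (rule borel_measurable_continuous_onI[OF density_trace_continuous[OF assms]])
  then show ?thesis
    by (rule measurable_compose[rotated]) (auto intro!: borel_measurable_continuous_onI continuous_intros)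
qed

lemma density_trace_pos: "smooth_positive_density \<rho> \<Longrightarrow> 0 < \<rho> (x, 0)"
  by (simp add: smooth_positive_density_def)

lemma time_strip_measurable [measurable]: "time_strip \<beta> T \<in> sets borel"
  unfolding time_strip_def by (intro borel_closed closed_Times) auto

lemma square_integrable_in_controls:
  assumes \<rho>: "smooth_positive_density \<rho>"
    and [measurable]: "f \<in> borel_measurable borel" and f: "integrable lborel (\<lambda>p. (f p)\<^sup>2)"
  shows "f \<in> controls \<rho> \<beta> T"
proof -
  note [measurable] = density_trace_measurable[OF \<rho>]
  have "compact ((\<lambda>x. \<rho> (x, 0)) ` {0..\<beta>})"
    using continuous_on_subset[OF density_trace_continuous[OF \<rho>]]
    by (rule compact_continuous_image) auto
  from compact_imp_bounded[OF this]
  obtain C where C: "\<forall>y \<in> (\<lambda>x. \<rho> (x, 0)) ` {0..\<beta>}. norm y \<le> C"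
    unfolding bounded_iff by blast
  have "integrable lborel (\<lambda>p. indicat_real (time_strip \<beta> T) p *\<^sub>R ((f p)\<^sup>2 * \<rho> (fst p, 0)))"
  proof (rule Bochner_Integration.integrable_bound)
    show "integrable lborel (\<lambda>p. C * (f p)\<^sup>2)"
      using f by simp
    have "\<bar>\<rho> (fst p, 0)\<bar> * (f p)\<^sup>2 \<le> \<bar>C\<bar> * (f p)\<^sup>2" if "p \<in> time_strip \<beta> T" for p
      using C that by (intro mult_right_mono) (force simp: time_strip_def)+
    then show "AE p in lborel. norm (indicat_real (time_strip \<beta> T) p *\<^sub>R ((f p)\<^sup>2 * \<rho> (fst p, 0)))
        \<le> norm (C * (f p)\<^sup>2)"
      by (intro AE_I2) (auto simp: indicator_def abs_mult mult.commute)
  qed measurable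
  then show ?thesis
    by (simp add: controls_def set_integrable_def)
qed

lemma inner_integrable:
  assumes \<rho>: "smooth_positive_density \<rho>" and f: "f \<in> controls \<rho> \<beta> T" and h: "h \<in> controls \<rho> \<beta> T"
  shows "set_integrable lborel (time_strip \<beta> T) (\<lambda>p. f p * h p * \<rho> (fst p, 0))"
proof -
  note [measurable] = density_trace_measurable[OF \<rho>]
  have [measurable]: "f \<in> borel_measurable borel" "h \<in> borel_measurable borel"
    using f h by (auto simp: controls_def)
  have le: "\<bar>f p * h p\<bar> \<le> (f p)\<^sup>2 + (h p)\<^sup>2" for p
  proof -
    have "2 * \<bar>f p * h p\<bar> \<le> (f p)\<^sup>2 + (h p)\<^sup>2"
      using sum_squares_bound[of "\<bar>f p\<bar>" "\<bar>h p\<bar>"] by (simp add: abs_mult)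
    then show ?thesis
      using abs_ge_zero[of "f p * h p"] by linarith
  qed
  have sq: "set_integrable lborel (time_strip \<beta> T)
      (\<lambda>p. (f p)\<^sup>2 * \<rho> (fst p, 0) + (h p)\<^sup>2 * \<rho> (fst p, 0))"
    using f h by (intro set_integral_add) (auto simp: controls_def)
  show ?thesis
    unfolding set_integrable_def
  proof (rule Bochner_Integration.integrable_bound[OF sq[unfolded set_integrable_def]])
    have "\<bar>f p * h p\<bar> * \<rho> (fst p, 0) \<le> ((f p)\<^sup>2 + (h p)\<^sup>2) * \<rho> (fst p, 0)" for p
      using le density_trace_pos[OF \<rho>] by (intro mult_right_mono) (auto intro: less_imp_le)
    then show "AE p in lborel. norm (indicat_real (time_strip \<beta> T) p *\<^sub>R (f p * h p * \<rho> (fst p, 0)))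
       \<le> norm (indicat_real (time_strip \<beta> T) p *\<^sub>R
           ((f p)\<^sup>2 * \<rho> (fst p, 0) + (h p)\<^sup>2 * \<rho> (fst p, 0)))"
      using density_trace_pos[OF \<rho>]
      by (intro AE_I2) (auto simp: indicator_def abs_mult distrib_right less_imp_le)
  qed measurable
qed

lemma control_inner_commute: "control_inner \<rho> \<beta> T f h = control_inner \<rho> \<beta> T h f"
  by (simp add: control_inner_def mult.commute)

lemma control_inner_add_left:
  assumes "smooth_positive_density \<rho>"
    and "f1 \<in> controls \<rho> \<beta> T" "f2 \<in> controls \<rho> \<beta> T" "h \<in> controls \<rho> \<beta> T"
  shows "control_inner \<rho> \<beta> T (\<lambda>p. f1 p + f2 p) h
    = control_inner \<rho> \<beta> T f1 h + control_inner \<rho> \<beta> T f2 h"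
  unfolding control_inner_def distrib_right
  by (intro set_integral_add inner_integrable assms)

lemma time_integral_measurable:
  assumes [measurable]: "f \<in> borel_measurable borel"
  shows "time_integral f \<in> borel_measurable borel"
proof -
  have [measurable]: "f \<in> borel_measurable (borel \<Otimes>\<^sub>M borel)"
    using assms by (simp add: borel_prod)
  have "(\<lambda>p. LINT s | lborel. (if 0 \<le> s \<and> s \<le> snd p then f (fst p, s) else 0))
      \<in> borel_measurable (borel \<Otimes>\<^sub>M borel)"
    by measurable
  moreover have "time_integral f
      = (\<lambda>p. LINT s | lborel. (if 0 \<le> s \<and> s \<le> snd p then f (fst p, s) else 0))"
    by (auto simp: time_integral_def set_lebesgue_integral_def indicator_def fun_eq_iff
        intro!: Bochner_Integration.integral_cong)
  ultimately show ?thesis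
    by (simp add: borel_prod)
qed

lemma time_integral_at_0: "time_integral f (x, 0) = 0"
proof -
  have "AE s in lborel. indicat_real {0..0} s *\<^sub>R f (x, s) = 0"
    using AE_lborel_singleton[of 0] by eventually_elim auto
  then show ?thesis
    by (simp only: time_integral_def set_lebesgue_integral_def prod.case integral_eq_zero_AE)
qed

text \<open>
  This is the Cauchy-Schwarz inequality in \<open>s\<close>, applied to \<open>f (x, s)\<close> and the constant one. With
  extended nonnegative integrals no exceptional lines \<open>x = const\<close> have to be excluded, and the
  right-hand side does not depend on \<open>t\<close>, so a second integration in time costs a constant only.
\<close>

lemma time_integral_square_le:
  assumes [measurable]: "f \<in> borel_measurable borel" and t: "t \<in> {0..2 * T}"
  shows "ennreal ((time_integral f (x, t))\<^sup>2)
    \<le> ennreal (2 * T) * (\<integral>\<^sup>+s. ennreal ((f (x, s))\<^sup>2) * indicator {0..2 * T} s \<partial>lborel)"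
proof -
  have [measurable]: "f \<in> borel_measurable (borel \<Otimes>\<^sub>M borel)"
    using assms by (simp add: borel_prod)
  define I where "I = (\<integral>\<^sup>+s. ennreal \<bar>f (x, s)\<bar> * indicator {0..2 * T} s \<partial>lborel)"
  have "ennreal \<bar>time_integral f (x, t)\<bar> \<le> I"
  proof (cases "integrable lborel (\<lambda>s. indicat_real {0..t} s *\<^sub>R f (x, s))")
    case True
    have "ennreal \<bar>time_integral f (x, t)\<bar>
        \<le> (\<integral>\<^sup>+s. norm (indicat_real {0..t} s *\<^sub>R f (x, s)) \<partial>lborel)"
      using integral_norm_bound_ennreal[OF True]
      by (simp add: time_integral_def set_lebesgue_integral_def)
    also have "\<dots> \<le> I"
      unfolding I_def using t by (intro nn_integral_mono) (auto simp: indicator_def)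
    finally show ?thesis .
  next
    case False
    then show ?thesis
      by (simp add: time_integral_def set_lebesgue_integral_def not_integrable_integral_eq)
  qed
  then have "(ennreal \<bar>time_integral f (x, t)\<bar>)\<^sup>2 \<le> I\<^sup>2"
    by (rule power_mono) simp
  also have "I\<^sup>2 = (\<integral>\<^sup>+s. (ennreal \<bar>f (x, s)\<bar> * indicator {0..2 * T} s) * indicator {0..2 * T} s \<partial>lborel)\<^sup>2"
    unfolding I_def by (intro arg_cong[where f = "\<lambda>a. a\<^sup>2"] nn_integral_cong) (auto simp: indicator_def)
  also have "\<dots> \<le> (\<integral>\<^sup>+s. (ennreal \<bar>f (x, s)\<bar> * indicator {0..2 * T} s)\<^sup>2 \<partial>lborel)
      * (\<integral>\<^sup>+s. (indicator {0..2 * T} s)\<^sup>2 \<partial>lborel)"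
    by (intro Cauchy_Schwarz_nn_integral) measurable
  also have "(\<integral>\<^sup>+s. (indicator {0..2 * T} s)\<^sup>2 \<partial>(lborel :: real measure))
      = (\<integral>\<^sup>+s. indicator {0..2 * T} s \<partial>(lborel :: real measure))"
    by (intro nn_integral_cong) (auto simp: indicator_def)
  also have "\<dots> = ennreal (2 * T)"
    using t by simp
  also have "(\<integral>\<^sup>+s. (ennreal \<bar>f (x, s)\<bar> * indicator {0..2 * T} s)\<^sup>2 \<partial>lborel)
      = (\<integral>\<^sup>+s. ennreal ((f (x, s))\<^sup>2) * indicator {0..2 * T} s \<partial>lborel)"
    by (intro nn_integral_cong) (auto simp: indicator_def ennreal_power)
  finally have "(ennreal \<bar>time_integral f (x, t)\<bar>)\<^sup>2
      \<le> (\<integral>\<^sup>+s. ennreal ((f (x, s))\<^sup>2) * indicator {0..2 * T} s \<partial>lborel) * ennreal (2 * T)" .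
  then show ?thesis
    by (subst mult.commute) (simp add: ennreal_power)
qed

lemma time_integral_in_controls:
  assumes \<rho>: "smooth_positive_density \<rho>" and f: "f \<in> controls \<rho> \<beta> T"
  shows "time_integral f \<in> controls \<rho> \<beta> T"
proof -
  have fm: "f \<in> borel_measurable borel"
    and fi: "integrable lborel (\<lambda>p. indicat_real (time_strip \<beta> T) p *\<^sub>R ((f p)\<^sup>2 * \<rho> (fst p, 0)))"
    using f by (auto simp: controls_def set_integrable_def)
  note [measurable] = fm time_integral_measurable[OF fm] density_trace_measurable[OF \<rho>]
  have [measurable]: "f \<in> borel_measurable (borel \<Otimes>\<^sub>M borel)"
      "time_integral f \<in> borel_measurable (borel \<Otimes>\<^sub>M borel)"
    using fm time_integral_measurable[OF fm] by (simp_all add: borel_prod)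
  have [measurable]: "(\<lambda>x. \<rho> (x, 0)) \<in> borel_measurable borel"
    by (rule borel_measurable_continuous_onI[OF density_trace_continuous[OF \<rho>]])
  have w: "0 \<le> \<rho> (x, 0)" for x
    using density_trace_pos[OF \<rho>, of x] by simp
  define S where "S x = (\<integral>\<^sup>+s. ennreal ((f (x, s))\<^sup>2) * indicator {0..2 * T} s \<partial>lborel)" for x
  have [measurable]: "S \<in> borel_measurable borel"
    unfolding S_def by measurable
  define W where "W x = ennreal (\<rho> (x, 0)) * indicator {0..\<beta>} x" for x
  have [measurable]: "W \<in> borel_measurable borel"
    unfolding W_def by measurable
  have fin: "(\<integral>\<^sup>+x. W x * S x \<partial>lborel) < \<infinity>"
  proof -
    have "(\<integral>\<^sup>+x. W x * S x \<partial>lborel)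
        = (\<integral>\<^sup>+x. (\<integral>\<^sup>+s. W x * (ennreal ((f (x, s))\<^sup>2) * indicator {0..2 * T} s) \<partial>lborel) \<partial>lborel)"
      unfolding S_def by (intro nn_integral_cong nn_integral_cmult[symmetric]) measurable
    also have "\<dots> = (\<integral>\<^sup>+p. W (fst p) * (ennreal ((f p)\<^sup>2) * indicator {0..2 * T} (snd p))
        \<partial>(lborel \<Otimes>\<^sub>M lborel))"
      by (subst lborel.nn_integral_fst[symmetric]) simp_all
    also have "\<dots> = (\<integral>\<^sup>+p. norm (indicat_real (time_strip \<beta> T) p *\<^sub>R ((f p)\<^sup>2 * \<rho> (fst p, 0))) \<partial>lborel)"
      unfolding lborel_prod W_def
      by (intro nn_integral_cong)
        (auto simp: indicator_def time_strip_def w abs_mult ennreal_mult'' mult.commute)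
    also have "\<dots> < \<infinity>"
      using fi by (simp add: integrable_iff_bounded)
    finally show ?thesis .
  qed
  have "(\<integral>\<^sup>+p. norm (indicat_real (time_strip \<beta> T) p *\<^sub>R ((time_integral f p)\<^sup>2 * \<rho> (fst p, 0))) \<partial>lborel)
      = (\<integral>\<^sup>+p. W (fst p) * (ennreal ((time_integral f p)\<^sup>2) * indicator {0..2 * T} (snd p))
        \<partial>(lborel \<Otimes>\<^sub>M lborel))"
    unfolding lborel_prod W_def
    by (intro nn_integral_cong)
      (auto simp: indicator_def time_strip_def w abs_mult ennreal_mult'' mult.commute)
  also have "\<dots> = (\<integral>\<^sup>+x. (\<integral>\<^sup>+t. W x * (ennreal ((time_integral f (x, t))\<^sup>2) * indicator {0..2 * T} t)
      \<partial>lborel) \<partial>lborel)"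
    by (subst lborel.nn_integral_fst[symmetric]) simp_all
  also have "\<dots> \<le> (\<integral>\<^sup>+x. (\<integral>\<^sup>+t. W x * (ennreal (2 * T) * S x) * indicator {0..2 * T} t
      \<partial>(lborel :: real measure)) \<partial>lborel)"
  proof (intro nn_integral_mono)
    fix x t :: real
    show "W x * (ennreal ((time_integral f (x, t))\<^sup>2) * indicator {0..2 * T} t)
        \<le> W x * (ennreal (2 * T) * S x) * indicator {0..2 * T} t"
      using time_integral_square_le[OF fm, of t T x]
      by (auto simp: indicator_def S_def intro!: mult_left_mono)
  qed
  also have "\<dots> = (\<integral>\<^sup>+x. emeasure lborel {0..2 * T} * ennreal (2 * T) * (W x * S x) \<partial>lborel)"
    by (intro nn_integral_cong, subst nn_integral_cmult_indicator) (simp_all add: mult_ac)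
  also have "\<dots> = emeasure lborel {0..2 * T} * ennreal (2 * T) * (\<integral>\<^sup>+x. W x * S x \<partial>lborel)"
    by (intro nn_integral_cmult) measurable
  also have "\<dots> < \<infinity>"
    using fin by (simp add: ennreal_mult_less_top emeasure_lborel_Icc_eq)
  finally have "integrable lborel
      (\<lambda>p. indicat_real (time_strip \<beta> T) p *\<^sub>R ((time_integral f p)\<^sup>2 * \<rho> (fst p, 0)))"
    by (intro integrableI_bounded) simp_all
  then show ?thesis
    using time_integral_measurable[OF fm] by (simp add: controls_def set_integrable_def)
qed

section \<open>Delays\<close>

definition delay :: "real \<Rightarrow> (real \<times> real \<Rightarrow> real) \<Rightarrow> real \<times> real \<Rightarrow> real" where
  "delay c f = (\<lambda>(x, t). f (x, t - c))"

lemma delay_apply [simp]: "delay c f (x, t) = f (x, t - c)"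
  by (simp add: delay_def)

text \<open>
  The kernel depends on \<open>t\<close> and \<open>s\<close> only through \<open>t - s\<close>, so substituting \<open>s + c\<close> for \<open>s\<close> turns
  the response to a delayed control at time \<open>t\<close> into the response to the original one at time
  \<open>t - c\<close>. The substitution moves the lower limit \<open>0\<close> to \<open>-c\<close>, which is harmless exactly because
  the control vanishes at negative times.
\<close>

lemma response_delay:
  assumes rep: "represented_by \<rho> \<beta> T R r"
    and f: "f \<in> controls \<rho> \<beta> T" and fc: "delay c f \<in> controls \<rho> \<beta> T"
    and past: "AE p in lborel. snd p < 0 \<longrightarrow> f p = 0" and c: "0 \<le> c"
  shows "AE (x, t) in lborel. (x, t) \<in> time_strip \<beta> T \<longrightarrow>
    R (delay c f) (x, t) = (if c \<le> t then R f (x, t - c) else 0)"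
proof -
  define K where "K h x t = (\<lambda>(x', s).
    indicat_real ({0..\<beta>} \<times> {0..t}) (x', s) * (r x x' (t - s) * h (x', s)))" for h x t
  have rep': "AE (x, t) in lborel. (x, t) \<in> time_strip \<beta> T \<longrightarrow>
      integrable lborel (K h x t) \<and> R h (x, t) = (LINT p | lborel. K h x t p)"
    if "h \<in> controls \<rho> \<beta> T" for h
    using rep[unfolded represented_by_def, rule_format, OF that]
  proof eventually_elim
    case (elim p)
    obtain x t where p: "p = (x, t)"
      by force
    have "integrable lborel (K h x t) \<and> R h (x, t) = (LINT p | lborel. K h x t p)"
      if st: "(x, t) \<in> time_strip \<beta> T"
    proof -
      have a: "set_integrable lborel ({0..\<beta>} \<times> {0..t}) (\<lambda>(x', s). r x x' (t - s) * h (x', s))"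
          "R h (x, t) = (LINT s : {0..t} | lborel. LINT x' : {0..\<beta>} | lborel. r x x' (t - s) * h (x', s))"
        using elim st p by auto
      from a(1) have "integrable lborel
          (\<lambda>p. indicat_real ({0..\<beta>} \<times> {0..t}) p *\<^sub>R (case p of (x', s) \<Rightarrow> r x x' (t - s) * h (x', s)))"
        by (simp add: set_integrable_def)
      moreover have "(\<lambda>p. indicat_real ({0..\<beta>} \<times> {0..t}) p *\<^sub>R
          (case p of (x', s) \<Rightarrow> r x x' (t - s) * h (x', s))) = K h x t"
        by (auto simp: K_def)
      ultimately have int: "integrable lborel (K h x t)"
        by simp
      have "(LINT s : {0..t} | lborel. LINT x' : {0..\<beta>} | lborel. r x x' (t - s) * h (x', s))
          = (LINT s | lborel. LINT x' | lborel. K h x t (x', s))"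
        unfolding set_lebesgue_integral_def K_def
        by (intro Bochner_Integration.integral_cong refl)
          (auto simp: indicator_times simp flip: integral_mult_right_zero
            intro!: Bochner_Integration.integral_cong)
      also have "\<dots> = (LINT p | lborel. K h x t p)"
        using lborel_pair.integral_snd[of "\<lambda>x' s. K h x t (x', s)"] int by (simp add: lborel_prod)
      finally show ?thesis
        using int a(2) by simp
    qed
    then show ?case
      by (simp add: p)
  qed
  (* For c > t the right-hand side is zero because the left-hand side only sees negative times. *)
  have shift: "AE p in lborel. K (delay c f) x t (p + (0, c))
      = (if c \<le> t then K f x (t - c) p else 0)" for x t
    using past
  proof eventually_elim
    case (elim p)
    then show ?case
      using c by (cases p) (auto simp: K_def indicator_def algebra_simps)
  qed
  from rep'[OF fc] AE_translate[OF rep'[OF f], of "(0, c)"] show ?thesis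
  proof eventually_elim
    case (elim p)
    obtain x t where p: "p = (x, t)"
      by force
    have "R (delay c f) (x, t) = (if c \<le> t then R f (x, t - c) else 0)"
      if st: "(x, t) \<in> time_strip \<beta> T"
    proof -
      have int: "integrable lborel (K (delay c f) x t)"
        and R1: "R (delay c f) (x, t) = (LINT q | lborel. K (delay c f) x t q)"
        using elim(1) st p by auto
      have [measurable]: "K (delay c f) x t \<in> borel_measurable borel"
        using int by auto
      have R2: "R (delay c f) (x, t) = (LINT q | lborel. K (delay c f) x t (q + (0, c)))"
        unfolding R1 by (rule integral_translate[symmetric]) measurable
      show ?thesis
      proof (cases "c \<le> t")
        case True
        then have "(x, t - c) \<in> time_strip \<beta> T"
          using st c by (auto simp: time_strip_def)
        then have int': "integrable lborel (K f x (t - c))"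
          and R3: "R f (x, t - c) = (LINT q | lborel. K f x (t - c) q)"
          using elim(2) p by auto
        have [measurable]: "K f x (t - c) \<in> borel_measurable borel"
          using int' by auto
        show ?thesis
          unfolding R2 R3 using True shift[of x t]
          by (auto intro!: integral_cong_AE)
      next
        case False
        then show ?thesis
          unfolding R2 using shift[of x t] by (auto intro!: integral_eq_zero_AE)
      qed
    qed
    then show ?case
      by (simp add: p)
  qed
qed

lemma time_integral_delay:
  assumes [measurable]: "u \<in> borel_measurable borel" "v \<in> borel_measurable borel" and c: "0 \<le> c"
    and uv: "AE (x, t) in lborel. (x, t) \<in> time_strip \<beta> T \<longrightarrow>
      v (x, t) = (if c \<le> t then u (x, t - c) else 0)"
  shows "AE (x, t) in lborel. (x, t) \<in> time_strip \<beta> T \<longrightarrow>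
    time_integral v (x, t) = (if c \<le> t then time_integral u (x, t - c) else 0)"
proof -
  have [measurable]: "u \<in> borel_measurable (borel \<Otimes>\<^sub>M borel)" "v \<in> borel_measurable (borel \<Otimes>\<^sub>M borel)"
    using assms by (simp_all add: borel_prod)
  have "AE x in lborel. AE s in lborel. (x, s) \<in> time_strip \<beta> T \<longrightarrow>
      v (x, s) = (if c \<le> s then u (x, s - c) else 0)"
    using AE_slices[OF uv] by simp
  from AE_fst[OF this] show ?thesis
  proof eventually_elim
    case (elim p)
    obtain x t where p: "p = (x, t)"
      by force
    have "time_integral v (x, t) = (if c \<le> t then time_integral u (x, t - c) else 0)"
      if st: "(x, t) \<in> time_strip \<beta> T"
    proof -
      define U where "U s = indicat_real {0..t - c} s * u (x, s)" for s
      have [measurable]: "U \<in> borel_measurable borel"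
        unfolding U_def by measurable
      have "time_integral v (x, t) = (LINT s | lborel. indicat_real {0..t} s * v (x, s))"
        by (simp add: time_integral_def set_lebesgue_integral_def)
      also have "\<dots> = (LINT s | lborel. U (s + - c))"
      proof (intro integral_cong_AE)
        show "AE s in lborel. indicat_real {0..t} s * v (x, s) = U (s + - c)"
          using elim
        proof eventually_elim
          case (elim s)
          then show ?case
            using st c p by (auto simp: U_def time_strip_def indicator_def)
        qed
      qed measurable
      also have "\<dots> = (LINT s | lborel. U s)"
        by (rule integral_translate) measurable
      also have "\<dots> = (if c \<le> t then time_integral u (x, t - c) else 0)"
        by (auto simp: U_def time_integral_def set_lebesgue_integral_def)
      finally show ?thesis .
    qed
    then show ?case
      by (simp add: p)
  qed
qed

text \<open>
  Substituting \<open>t + c\<close> for \<open>t\<close> removes the common delay \<open>c\<close> but moves the strip. The condition on the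
  support of \<open>h\<close> keeps both \<open>h\<close> and its delay inside the strip, so that the change of the domain of
  integration has no effect.
\<close>

lemma control_inner_delay:
  assumes \<rho>: "smooth_positive_density \<rho>"
    and [measurable]: "m \<in> borel_measurable borel" "n \<in> borel_measurable borel"
      "h \<in> borel_measurable borel"
    and c: "0 \<le> c"
    and mn: "AE (x, t) in lborel. (x, t) \<in> time_strip \<beta> T \<longrightarrow>
      n (x, t) = (if c \<le> t then m (x, t - c) else 0)"
    and supp: "AE p in lborel. snd p \<notin> {0..2 * T - c} \<longrightarrow> h p = 0"
  shows "control_inner \<rho> \<beta> T n (delay c h) = control_inner \<rho> \<beta> T m h"
proof -
  note [measurable] = density_trace_measurable[OF \<rho>]
  have [measurable]: "delay c h \<in> borel_measurable borel"
  proof -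
    have "delay c h = h \<circ> (\<lambda>p. p - (0, c))"
      by (auto simp: fun_eq_iff)
    then show ?thesis
      by simp
  qed
  define I where "I p = indicat_real (time_strip \<beta> T) p * (m p * h p * \<rho> (fst p, 0))" for p
  have [measurable]: "I \<in> borel_measurable borel"
    unfolding I_def by measurable
  have "control_inner \<rho> \<beta> T n (delay c h)
      = (LINT p | lborel. indicat_real (time_strip \<beta> T) p * (n p * delay c h p * \<rho> (fst p, 0)))"
    by (simp add: control_inner_def set_lebesgue_integral_def)
  also have "\<dots> = (LINT p | lborel. I (p + - (0, c)))"
  proof (intro integral_cong_AE)
    show "AE p in lborel. indicat_real (time_strip \<beta> T) p * (n p * delay c h p * \<rho> (fst p, 0))
        = I (p + - (0, c))"
      using mn AE_translate[OF supp, of "(0, c)"]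
    proof eventually_elim
      case (elim p)
      then show ?case
        using c by (cases p) (auto simp: I_def time_strip_def indicator_def)
    qed
  qed measurable
  also have "\<dots> = (LINT p | lborel. I p)"
    by (rule integral_translate) measurable
  finally show ?thesis
    by (simp add: I_def control_inner_def set_lebesgue_integral_def)
qed

section \<open>The Gram matrix\<close>

lemma delay_shifted: "delay (real a * \<delta>) (shifted \<epsilon> \<delta> g i j) = shifted \<epsilon> \<delta> g (i + a) j"
  by (auto simp: delay_def shifted_def fun_eq_iff algebra_simps)

lemma shifted_translate: "shifted \<epsilon> \<delta> g i j = (\<lambda>p. g (p - (real j * \<epsilon>, real i * \<delta>)))"
  by (auto simp: shifted_def fun_eq_iff)

lemma shifted_measurable:
  assumes [measurable]: "g \<in> borel_measurable borel"
  shows "shifted \<epsilon> \<delta> g i j \<in> borel_measurable borel"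
  unfolding shifted_translate by measurable

lemma shifted_in_controls:
  assumes \<rho>: "smooth_positive_density \<rho>"
    and g: "g \<in> borel_measurable borel" "integrable lborel (\<lambda>p. (g p)\<^sup>2)"
  shows "shifted \<epsilon> \<delta> g i j \<in> controls \<rho> \<beta> T"
proof (rule square_integrable_in_controls[OF \<rho> shifted_measurable[OF g(1)]])
  define a where "a = (real j * \<epsilon>, real i * \<delta>)"
  have "integrable (distr lborel borel ((+) (- a))) (\<lambda>p. (g p)\<^sup>2)"
    using g(2) by (simp only: lborel_distr_plus)
  then have "integrable lborel (\<lambda>p. (g (- a + p))\<^sup>2)"
    using g(1) by (subst (asm) integrable_distr_eq) auto
  then show "integrable lborel (\<lambda>p. (shifted \<epsilon> \<delta> g i j p)\<^sup>2)"
    by (simp add: shifted_translate flip: a_def)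
qed

lemma shifted_support:
  assumes "ess_support g = {0..\<epsilon>} \<times> {0..\<delta>}"
  shows "AE p in lborel. snd p \<notin> {real i * \<delta>..real (i + 1) * \<delta>} \<longrightarrow> shifted \<epsilon> \<delta> g i j p = 0"
  using AE_translate[OF AE_zero_off_ess_support[of g], of "(real j * \<epsilon>, real i * \<delta>)"]
proof eventually_elim
  case (elim p)
  then show ?case
    by (cases p) (auto simp: assms shifted_translate algebra_simps)
qed


theorem mainTheorem1:
  fixes T \<beta> \<epsilon> \<delta> :: real
    and \<rho> :: "real \<times> real \<Rightarrow> real"
    and R MT MTadj :: "(real \<times> real \<Rightarrow> real) \<Rightarrow> real \<times> real \<Rightarrow> real"
    and r :: "real \<Rightarrow> real \<Rightarrow> real \<Rightarrow> real"
    and M N :: nat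
    and g :: "real \<times> real \<Rightarrow> real"
    and G :: "nat \<Rightarrow> nat \<Rightarrow> nat \<Rightarrow> nat \<Rightarrow> real"
  assumes "0 < T" and "0 < \<beta>"
    and "smooth_positive_density \<rho>"
    and "well_posed \<rho> \<beta> T"
    and "response_operator \<rho> \<beta> T R"
    and "piecewise_continuous_on ({0..\<beta>} \<times> {0..\<beta>} \<times> {0..2 * T}) (\<lambda>(x, x', t). r x x' t)"
    and "represented_by \<rho> \<beta> T R r"
    and "MT = time_integral \<circ> R"
    and "adjoint_of \<rho> \<beta> T MT MTadj"
    and "1 \<le> M" and "1 \<le> N"
    and "\<epsilon> = \<beta> / real M" and "\<delta> = 2 * T / real N"
    and "g \<in> borel_measurable borel" and "integrable lborel (\<lambda>p. (g p)\<^sup>2)"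
    and "ess_support g = {0..\<epsilon>} \<times> {0..\<delta>}"
    and "G = (\<lambda>i k j l. control_inner \<rho> \<beta> T
                (\<lambda>p. MT (shifted \<epsilon> \<delta> g i j) p + MTadj (shifted \<epsilon> \<delta> g i j) p)
                (shifted \<epsilon> \<delta> g k l))"
  shows "block_toeplitz N M G"
proof -
  note \<rho> = assms(3) and rep = assms(7) and g = assms(14,15) and supp = shifted_support[OF assms(16)]
  define \<phi> where "\<phi> = shifted \<epsilon> \<delta> g"
  have \<delta>: "0 \<le> \<delta>"
    using assms by simp
  have N\<delta>: "real N * \<delta> = 2 * T"
    using assms by simp
  have \<phi>: "\<phi> i j \<in> controls \<rho> \<beta> T" for i j
    unfolding \<phi>_def by (rule shifted_in_controls[OF \<rho> g])
  have \<phi>m: "\<phi> i j \<in> borel_measurable borel" for i j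
    unfolding \<phi>_def by (rule shifted_measurable[OF g(1)])
  have R: "R f \<in> controls \<rho> \<beta> T" if "f \<in> controls \<rho> \<beta> T" for f
    using assms(5) that by (auto simp: response_operator_def)
  then have MT: "MT f \<in> controls \<rho> \<beta> T" if "f \<in> controls \<rho> \<beta> T" for f
    using that time_integral_in_controls[OF \<rho>] assms(8) by simp
  have meas: "f \<in> borel_measurable borel" if "f \<in> controls \<rho> \<beta> T" for f
    using that by (simp add: controls_def)
  define A where "A i k j l = control_inner \<rho> \<beta> T (MT (\<phi> i j)) (\<phi> k l)" for i k j l

  have G: "G i k j l = A i k j l + A k i l j" for i k j l
  proof -
    have adj: "MTadj (\<phi> i j) \<in> controls \<rho> \<beta> T"
      "control_inner \<rho> \<beta> T (MT (\<phi> k l)) (\<phi> i j) = control_inner \<rho> \<beta> T (\<phi> k l) (MTadj (\<phi> i j))"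
      using assms(9) \<phi> by (auto simp: adjoint_of_def)
    then show ?thesis
      using control_inner_add_left[OF \<rho> MT[OF \<phi>] adj(1) \<phi>]
      by (simp add: assms(17) A_def control_inner_commute flip: \<phi>_def)
  qed

  have MT_shift: "AE (x, t) in lborel. (x, t) \<in> time_strip \<beta> T \<longrightarrow>
      MT (\<phi> i j) (x, t) = (if real i * \<delta> \<le> t then MT (\<phi> 0 j) (x, t - real i * \<delta>) else 0)" for i j
  proof -
    have d: "delay (real i * \<delta>) (\<phi> 0 j) = \<phi> i j"
      by (simp add: \<phi>_def delay_shifted)
    have "AE p in lborel. snd p < 0 \<longrightarrow> \<phi> 0 j p = 0"
      using supp[of 0 j] by eventually_elim (auto simp: \<phi>_def)
    from response_delay[OF rep \<phi>[of 0 j], of "real i * \<delta>", unfolded d, OF \<phi> this]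
    show ?thesis
      unfolding assms(8) o_def using \<delta> by (intro time_integral_delay meas R \<phi>) simp_all
  qed

  have lower: "A i (i + d) j l = A 0 d j l" if "i + d < N" for i d j l
  proof -
    have d: "delay (real i * \<delta>) (\<phi> d l) = \<phi> (i + d) l"
      by (simp add: \<phi>_def delay_shifted add.commute)
    have "real (i + d + 1) * \<delta> \<le> 2 * T"
      unfolding N\<delta>[symmetric] using that \<delta> by (intro mult_right_mono) auto
    then have le: "real (d + 1) * \<delta> \<le> 2 * T - real i * \<delta>"
      by (simp add: algebra_simps)
    have "AE p in lborel. snd p \<notin> {0..2 * T - real i * \<delta>} \<longrightarrow> \<phi> d l p = 0"
      using supp[of d l]
    proof eventually_elim
      case (elim p)
      have "0 \<le> real d * \<delta>"
        using \<delta> by simp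
      then show ?case
        using elim le by (force simp: \<phi>_def)
    qed
    then show ?thesis
      unfolding A_def d[symmetric]
      using \<delta> by (intro control_inner_delay[OF \<rho> _ _ _ _ MT_shift] meas MT \<phi>) auto
  qed

  have upper: "A i k j l = 0" if "k < i" for i k j l
  proof -
    have le: "real (k + 1) * \<delta> \<le> real i * \<delta>"
      using that \<delta> by (intro mult_right_mono) auto
    (* At the time i * \<delta> itself the supports may touch, but there the integral is over one point. *)
    have zero: "MT f (x, 0) = 0" for f x
      by (simp add: assms(8) time_integral_at_0)
    have "AE p in lborel. indicat_real (time_strip \<beta> T) p
        * (MT (\<phi> i j) p * \<phi> k l p * \<rho> (fst p, 0)) = 0"
      using MT_shift[of i j] supp[of k l]
    proof eventually_elim
      case (elim p)
      obtain x t where p: "p = (x, t)"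
        by force
      have "MT (\<phi> i j) p = 0 \<or> \<phi> k l p = 0" if st: "p \<in> time_strip \<beta> T"
      proof (cases "t \<le> real i * \<delta>")
        case True
        have "MT (\<phi> i j) (x, t) = (if real i * \<delta> \<le> t then MT (\<phi> 0 j) (x, t - real i * \<delta>) else 0)"
          using elim(1) st unfolding p by simp
        also have "\<dots> = 0"
        proof (cases "real i * \<delta> \<le> t")
          case i: True
          then have "t - real i * \<delta> = 0"
            using True by simp
          with i show ?thesis
            by (simp only: if_True zero)
        qed simp
        finally show ?thesis
          by (simp add: p)
      next
        case False
        then show ?thesis
          using elim(2) le unfolding p \<phi>_def by simp
      qed
      then show ?case
        by (auto simp: indicator_def)
    qed
    then show ?thesis
      by (simp add: A_def control_inner_def set_lebesgue_integral_def integral_eq_zero_AE)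
  qed

  (* Both summands contribute on the block diagonal d = 0. *)
  define B where "B d j l = (if 0 \<le> d then A 0 (nat d) j l else 0)
    + (if d \<le> 0 then A 0 (nat (- d)) l j else 0)" for d j l
  have A: "A i k j l = (if i \<le> k then A 0 (k - i) j l else 0)" if "k < N" for i k j l
    using lower[of i "k - i"] upper[of k i] that by auto
  have "G i k j l = B (int k - int i) j l" if "i < N" "k < N" for i k j l
  proof -
    have "nat (int k - int i) = k - i" "nat (- (int k - int i)) = i - k"
      by simp_all
    then show ?thesis
      unfolding G B_def A[OF that(2), of i j l] A[OF that(1), of k l j] by simp
  qed
  then show ?thesis
    unfolding block_toeplitz_def by blast
qed

end
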